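(* Let $F$ be a vector field defined on an open set $\Omega\subset\mathbb R^3$ that is $\mathbb A$-algebrizable with respect to an algebra $\mathbb A$ on $\mathbb R^3$ with unit $e$, and let $E_i=e_iF$ for $i=1,2,3$, where $e_iF$ denotes the product of $e_i$ and $F$ with respect to $\mathbb A$. Then the metric $g=\frac{1}{\|e\|^2}H^*\lambda$ defined on $\Omega(F,\mathbb A^* )$ is given by $$g=\begin{pmatrix} a_1 & a_2 & a_3 \\ {} a_2 & a_4 & a_5 \\ {} a_3 & a_5 & a_6 \end{pmatrix},$$ where $a_1,a_2,a_3,a_4,a_5,a_6$ are the solutions of the linear system of the six equations $$E_i\,g\,E_i^T=1,\quad i=1,2,3,\qquad E_i\,g\,E_j^T=0,\quad i,j\in\{1,2,3\},\ i<j.$$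
   Context: An algebra $\mathbb A$ on $\mathbb R^3$ is the linear space $\mathbb R^3$ (canonical basis $e_1,e_2,e_3$) endowed with a bilinear, associative, commutative product with unit $e$. $\mathbb A^*$ is the set of regular (invertible) elements; the inverse of $a$ is written $\frac ea$. A vector field $F:\Omega\to\mathbb R^3$, $\Omega\subset\mathbb R^3$ open, is $\mathbb A$-algebrizable if there is $F':\Omega\to\mathbb R^3$ with $\lim_{\xi\to0}|F(w+\xi)-F(w)-F'(w)\xi|/|\xi|=0$ for all $w\in\Omega$ (product in $\mathbb A$). $\Omega(F,\mathbb A^* )=F^{-1}(\mathbb A^* )$. $H$ is the (possibly multivalued) function on $\Omega(F,\mathbb A^* )$ given locally by $H(w)=\int_\gamma\frac eF\,d\xi:=\int_0^a\frac e{F(\gamma(t))}\dot\gamma(t)\,dt$ (product in $\mathbb A$), where $\gamma:[0,a]\to\Omega(F,\mathbb A^* )$ is a differentiable curve from a base point $w_0$ (one fixed in each connected component) to $w$; its local branches differ by constants, so the pullback $H^*\lambda$ is well defined. $\|e\|$ is the Euclidean norm of $e$, and $\lambda$ ($\lambda_{ij}=\delta_{ij}$) is the natural Riemannian metric of $\mathbb R^3$. In the equations, $E_i$ is a row vector, $^T$ denotes the transpose, and $g$ is identified with its matrix of coefficients in the coordinates $(x_1,x_2,x_3)$ at each point.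
   Formalization: As printed this fails if ‖e‖≠1 (componentwise product, F=e=(1,1,1): E_1 g E_1^T=1/3). Proved: the a_k are the unique solution with E_i g E_i^T=1/‖e‖² in place of 1, and the unique solution of the printed system exactly when ‖e‖=1. *)

theory Defs
  imports "HOL-Analysis.Analysis"
begin

definition algebra_on_R3 :: "(real^3 \<Rightarrow> real^3 \<Rightarrow> real^3) \<Rightarrow> real^3 \<Rightarrow> bool" where
  "algebra_on_R3 m e \<longleftrightarrow>
     bilinear m \<and>
     (\<forall>x y z. m (m x y) z = m x (m y z)) \<and>
     (\<forall>x y. m x y = m y x) \<and>
     (\<forall>x. m e x = x)"

definition regular_elements :: "(real^3 \<Rightarrow> real^3 \<Rightarrow> real^3) \<Rightarrow> real^3 \<Rightarrow> (real^3) set" where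
  "regular_elements m e = {a. \<exists>b. m a b = e}"

definition alg_inverse :: "(real^3 \<Rightarrow> real^3 \<Rightarrow> real^3) \<Rightarrow> real^3 \<Rightarrow> real^3 \<Rightarrow> real^3" where
  "alg_inverse m e a = (THE b. m a b = e)"

definition algebrizable_on ::
    "(real^3 \<Rightarrow> real^3 \<Rightarrow> real^3) \<Rightarrow> (real^3 \<Rightarrow> real^3) \<Rightarrow> (real^3) set \<Rightarrow> bool" where
  "algebrizable_on m F \<Omega> \<longleftrightarrow>
     (\<exists>F'. \<forall>w\<in>\<Omega>. ((\<lambda>\<xi>. norm (F (w + \<xi>) - F w - m (F' w) \<xi>) / norm \<xi>) \<longlongrightarrow> 0) (at 0))"

definition regular_domain ::
    "(real^3 \<Rightarrow> real^3 \<Rightarrow> real^3) \<Rightarrow> real^3 \<Rightarrow> (real^3 \<Rightarrow> real^3) \<Rightarrow> (real^3) set \<Rightarrow> (real^3) set" where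
  "regular_domain m e F \<Omega> = {w \<in> \<Omega>. F w \<in> regular_elements m e}"

definition differentiable_curve ::
    "(real^3) set \<Rightarrow> real \<Rightarrow> (real \<Rightarrow> real^3) \<Rightarrow> real^3 \<Rightarrow> real^3 \<Rightarrow> bool" where
  "differentiable_curve S a \<gamma> p q \<longleftrightarrow>
     0 < a \<and> (\<forall>t\<in>{0..a}. \<gamma> t \<in> S \<and> \<gamma> differentiable (at t within {0..a})) \<and>
     \<gamma> 0 = p \<and> \<gamma> a = q"

(* The integral of (e/F) d xi along the curve exists and equals I.  Since a differentiable curve
   need not have a Lebesgue integrable velocity, the Henstock-Kurzweil integral is the right one. *)
definition has_curve_integral ::
    "(real^3 \<Rightarrow> real^3 \<Rightarrow> real^3) \<Rightarrow> real^3 \<Rightarrow> (real^3 \<Rightarrow> real^3) \<Rightarrow>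
     real \<Rightarrow> (real \<Rightarrow> real^3) \<Rightarrow> real^3 \<Rightarrow> bool" where
  "has_curve_integral m e F a \<gamma> I \<longleftrightarrow>
     ((\<lambda>t. m (alg_inverse m e (F (\<gamma> t))) (vector_derivative \<gamma> (at t within {0..a})))
        has_integral I) {0..a}"

(* The set of values at w of the multivalued function H; base C is the base point of the
   connected component C of the regular domain. *)
definition H_values ::
    "(real^3 \<Rightarrow> real^3 \<Rightarrow> real^3) \<Rightarrow> real^3 \<Rightarrow> (real^3 \<Rightarrow> real^3) \<Rightarrow> (real^3) set \<Rightarrow>
     ((real^3) set \<Rightarrow> real^3) \<Rightarrow> real^3 \<Rightarrow> (real^3) set" where
  "H_values m e F \<Omega> base w =
     {I. \<exists>a \<gamma>. differentiable_curve (regular_domain m e F \<Omega>) a \<gamma>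
                 (base (connected_component_set (regular_domain m e F \<Omega>) w)) w \<and>
               has_curve_integral m e F a \<gamma> I}"

(* A local branch picks one value of H at every point of U, consistently along all curves in U. *)
definition H_branch ::
    "(real^3 \<Rightarrow> real^3 \<Rightarrow> real^3) \<Rightarrow> real^3 \<Rightarrow> (real^3 \<Rightarrow> real^3) \<Rightarrow> (real^3) set \<Rightarrow>
     ((real^3) set \<Rightarrow> real^3) \<Rightarrow> (real^3) set \<Rightarrow> (real^3 \<Rightarrow> real^3) \<Rightarrow> bool" where
  "H_branch m e F \<Omega> base U h \<longleftrightarrow>
     open U \<and> connected U \<and> U \<subseteq> regular_domain m e F \<Omega> \<and>
     (\<forall>p\<in>U. h p \<in> H_values m e F \<Omega> base p) \<and>
     (\<forall>a \<gamma> p q. differentiable_curve U a \<gamma> p q \<longrightarrow> has_curve_integral m e F a \<gamma> (h q - h p))"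

type_synonym metric_field = "real^3 \<Rightarrow> real^3 \<Rightarrow> real^3 \<Rightarrow> real"

definition natural_metric :: metric_field where
  "natural_metric p u v = u \<bullet> v"

definition pullback :: "(real^3 \<Rightarrow> real^3) \<Rightarrow> metric_field \<Rightarrow> metric_field" where
  "pullback h \<mu> w u v =
     \<mu> (h w) (frechet_derivative h (at w) u) (frechet_derivative h (at w) v)"

(* The pullback under the multivalued H: the common value of the pullbacks under all
   local branches of H near w. *)
definition H_pullback ::
    "(real^3 \<Rightarrow> real^3 \<Rightarrow> real^3) \<Rightarrow> real^3 \<Rightarrow> (real^3 \<Rightarrow> real^3) \<Rightarrow> (real^3) set \<Rightarrow>
     ((real^3) set \<Rightarrow> real^3) \<Rightarrow> metric_field \<Rightarrow> metric_field" where
  "H_pullback m e F \<Omega> base \<mu> w =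
     (THE \<beta>. \<exists>U h. w \<in> U \<and> H_branch m e F \<Omega> base U h \<and> \<beta> = pullback h \<mu> w)"

definition alg_metric ::
    "(real^3 \<Rightarrow> real^3 \<Rightarrow> real^3) \<Rightarrow> real^3 \<Rightarrow> (real^3 \<Rightarrow> real^3) \<Rightarrow> (real^3) set \<Rightarrow>
     ((real^3) set \<Rightarrow> real^3) \<Rightarrow> metric_field" where
  "alg_metric m e F \<Omega> base w u v =
     1 / (norm e)\<^sup>2 * H_pullback m e F \<Omega> base natural_metric w u v"

definition coefficient_matrix :: "metric_field \<Rightarrow> real^3 \<Rightarrow> real^3^3" where
  "coefficient_matrix g w = (\<chi> i j. g w (axis i 1) (axis j 1))"

definition symmetric_matrix ::
    "real \<Rightarrow> real \<Rightarrow> real \<Rightarrow> real \<Rightarrow> real \<Rightarrow> real \<Rightarrow> real^3^3" where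
  "symmetric_matrix a1 a2 a3 a4 a5 a6 =
     vector [vector [a1, a2, a3], vector [a2, a4, a5], vector [a3, a5, a6]]"

(* The six equations E_i G E_i^T = c and E_i G E_j^T = 0 (i < j), where E_i = e_i F(w).
   They are listed one by one because in the index type 3 the numeral 3 denotes 0, so that its
   order is not 1 < 2 < 3. *)
definition frame_system ::
    "(real^3 \<Rightarrow> real^3 \<Rightarrow> real^3) \<Rightarrow> (real^3 \<Rightarrow> real^3) \<Rightarrow> real^3 \<Rightarrow> real \<Rightarrow> real^3^3 \<Rightarrow> bool" where
  "frame_system m F w c G \<longleftrightarrow>
     (let E = (\<lambda>i::3. m (axis i 1) (F w)) in
        (E 1 v* G) \<bullet> E 1 = c \<and> (E 2 v* G) \<bullet> E 2 = c \<and> (E 3 v* G) \<bullet> E 3 = c \<and>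
        (E 1 v* G) \<bullet> E 2 = 0 \<and> (E 1 v* G) \<bullet> E 3 = 0 \<and> (E 2 v* G) \<bullet> E 3 = 0)"

(* Every local branch h of H has derivative v |-> (e/F) v, so the derivative maps E_i to e_i and
   g(E_i, E_j) = delta_ij / ||e||^2.  Hence the right-hand side c of the diagonal equations is
   1 / ||e||^2; it is 1 exactly when the unit has Euclidean norm 1. *)

end

theory Submission
  imports Defs
begin

text \<open>The content of the statement is that every local branch \<open>h\<close> of the multivalued function
\<open>H\<close> has derivative \<open>v \<mapsto> (e/F) v\<close>, together with the fact that such
branches exist around every regular point. Given this, the derivative of \<open>h\<close> at \<open>w\<close> maps
\<open>E\<^sub>i = e\<^sub>i F(w)\<close> to \<open>e\<^sub>i\<close>, so the frame \<open>E\<^sub>1, E\<^sub>2, E\<^sub>3\<close> is orthogonal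
for the pullback metric with all squared lengths \<open>1\<close>, hence \<open>1 / \<parallel>e\<parallel>\<^sup>2\<close> after
normalisation. A symmetric bilinear form is determined by its values on a basis, which is the
uniqueness of the solution of the linear system. The system with right-hand side \<open>1\<close> has the
solution \<open>\<parallel>e\<parallel>\<^sup>2 g\<close>, and \<open>g\<close> is nonzero, so this is \<open>g\<close> exactly for a unit of
Euclidean norm \<open>1\<close>.

The existence of branches needs a primitive of \<open>e/F\<close> on balls. The derivative of \<open>F\<close> is
not assumed to be continuous, so differentiation under the integral sign is not available and
the argument is that of Goursat (\<open>triangle_integral_zero\<close>): near a point the form
\<open>v \<mapsto> (e/F) v\<close> agrees to first order with an exact form, and repeated quadrisection of a
triangle with nonzero boundary integral contradicts this. What makes the first-order part exact
is that the derivative of \<open>x \<mapsto> f(x) v\<close> in direction \<open>u\<close> is symmetric in \<open>u\<close> and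
\<open>v\<close>; in a commutative associative algebra this holds for every algebrizable field \<open>f\<close>
(\<open>symmetric_derivative_imp_primitive\<close>), and \<open>e/F\<close> is one (\<open>has_derivative_alg_inverse\<close>).

The values of \<open>H\<close> are integrals along curves that are differentiable everywhere, so a
polygonal path run through at unit speed is not admissible. Connecting curves are built from pieces that come to rest at
both ends; such pieces join differentiably (\<open>rest_curve_join\<close>), and connectedness of a
component yields a curve from its base point to any of its points.\<close>

section \<open>Primitives of differentiable one-forms on convex sets\<close>

text \<open>A one-form is encoded as a map \<open>\<omega>\<close> that takes the point first and the tangent vector second,
with \<open>\<omega> x\<close> linear for every \<open>x\<close>.\<close>

definition segment_integral ::
    "('a::euclidean_space \<Rightarrow> 'a \<Rightarrow> 'b::euclidean_space) \<Rightarrow> 'a \<Rightarrow> 'a \<Rightarrow> 'b" where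
  "segment_integral \<omega> a b = integral {0..1} (\<lambda>t. \<omega> (a + t *\<^sub>R (b - a)) (b - a))"

lemma segment_point_in:
  assumes "closed_segment a b \<subseteq> S" "t \<in> {0..1::real}"
  shows "a + t *\<^sub>R (b - a) \<in> S"
proof -
  have "a + t *\<^sub>R (b - a) \<in> closed_segment a b"
    using assms(2) unfolding closed_segment_def
    by (auto intro!: exI[of _ t] simp: algebra_simps)
  then show ?thesis using assms(1) by blast
qed

lemma has_integral_segment_integral:
  assumes "closed_segment a b \<subseteq> S" and "\<And>v. continuous_on S (\<lambda>x. \<omega> x v)"
  shows "((\<lambda>t. \<omega> (a + t *\<^sub>R (b - a)) (b - a)) has_integral segment_integral \<omega> a b) {0..1}"
proof -
  have "continuous_on {0..1} ((\<lambda>x. \<omega> x (b - a)) \<circ> (\<lambda>t::real. a + t *\<^sub>R (b - a)))"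
    by (intro continuous_on_compose continuous_intros continuous_on_subset[OF assms(2)])
       (use segment_point_in[OF assms(1)] in auto)
  then have "(\<lambda>t. \<omega> (a + t *\<^sub>R (b - a)) (b - a)) integrable_on {0..1::real}"
    by (intro integrable_continuous_real) (simp add: o_def)
  then show ?thesis
    unfolding segment_integral_def by (rule integrable_integral)
qed

lemma segment_integral_reverse:
  assumes "closed_segment a b \<subseteq> S" and "\<And>v. continuous_on S (\<lambda>x. \<omega> x v)"
    and lin: "\<And>x. linear (\<omega> x)"
  shows "segment_integral \<omega> b a = - segment_integral \<omega> a b"
proof -
  have "((\<lambda>t. \<omega> (a + ((-1) * t + 1) *\<^sub>R (b - a)) (b - a)) has_integral segment_integral \<omega> a b)
          ((\<lambda>x. (1 / (-1)) *\<^sub>R x + -((1 / (-1)) *\<^sub>R 1)) ` cbox 0 (1::real))"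
    using has_integral_affinity[of "\<lambda>t. \<omega> (a + t *\<^sub>R (b - a)) (b - a)"
        "segment_integral \<omega> a b" 0 1 "-1::real" 1]
      has_integral_segment_integral[of a b S \<omega>, OF assms(1,2)] by simp
  also have "(\<lambda>x. (1 / (-1)) *\<^sub>R x + -((1 / (-1)) *\<^sub>R 1)) ` cbox 0 (1::real) = {0..1}"
    using image_affinity_atLeastAtMost[of "-1::real" 1 0 1] by simp
  also have "(\<lambda>t::real. \<omega> (a + ((-1) * t + 1) *\<^sub>R (b - a)) (b - a))
           = (\<lambda>t. - \<omega> (b + t *\<^sub>R (a - b)) (a - b))"
  proof
    fix t :: real
    have "a + ((-1) * t + 1) *\<^sub>R (b - a) = b + t *\<^sub>R (a - b)" by (simp add: algebra_simps)
    moreover have "\<omega> x (b - a) = - \<omega> x (a - b)" for x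
      using linear_neg[OF lin, of x "a - b"] by simp
    ultimately show "\<omega> (a + ((-1) * t + 1) *\<^sub>R (b - a)) (b - a) = - \<omega> (b + t *\<^sub>R (a - b)) (a - b)"
      by simp
  qed
  finally have "((\<lambda>t. - \<omega> (b + t *\<^sub>R (a - b)) (a - b)) has_integral segment_integral \<omega> a b) {0..1}" .
  from has_integral_neg[OF this]
  have "((\<lambda>t. \<omega> (b + t *\<^sub>R (a - b)) (a - b)) has_integral - segment_integral \<omega> a b) {0..1}"
    by simp
  then show ?thesis unfolding segment_integral_def by (rule integral_unique)
qed

lemma segment_integral_midpoint:
  assumes "closed_segment a b \<subseteq> S" and "\<And>v. continuous_on S (\<lambda>x. \<omega> x v)"
    and lin: "\<And>x. linear (\<omega> x)"
  shows "segment_integral \<omega> a b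
       = segment_integral \<omega> a (midpoint a b) + segment_integral \<omega> (midpoint a b) b"
proof -
  let ?c = "midpoint a b"
  have c: "?c \<in> closed_segment a b" by simp
  then have sub: "closed_segment a ?c \<subseteq> S" "closed_segment ?c b \<subseteq> S"
    using assms(1) subset_closed_segment by (metis ends_in_segment order_trans)+
  have half1: "?c - a = (1/2) *\<^sub>R (b - a)" and half2: "b - ?c = (1/2) *\<^sub>R (b - a)"
    by (simp_all add: midpoint_def algebra_simps flip: scaleR_add_left)
  have sc: "\<omega> x ((1/2) *\<^sub>R v) = (1/2) *\<^sub>R \<omega> x v" for x v
    using linear_cmul[OF lin] .
  let ?g = "\<lambda>t::real. \<omega> (a + t *\<^sub>R (b - a)) (b - a)"
  have 1: "(?g has_integral segment_integral \<omega> a ?c) {0..1/2}"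
  proof -
    have "((\<lambda>t. (1/2) *\<^sub>R \<omega> (a + (t / 2) *\<^sub>R (b - a)) (b - a)) has_integral segment_integral \<omega> a ?c) (cbox 0 1)"
      using has_integral_segment_integral[of _ _ S \<omega>, OF sub(1) assms(2)]
      by (simp add: half1 sc)
    from has_integral_affinity[OF this, of "2::real" 0]
    have "((\<lambda>t. (1/2) *\<^sub>R ?g t) has_integral (1/2) *\<^sub>R segment_integral \<omega> a ?c)
            ((\<lambda>x. (1 / 2) *\<^sub>R x + -((1 / 2) *\<^sub>R 0)) ` cbox 0 (1::real))" by simp
    also have "(\<lambda>x. (1 / 2) *\<^sub>R x + -((1 / 2) *\<^sub>R 0)) ` cbox 0 (1::real) = {0..1/2}"
      using image_affinity_atLeastAtMost[of "1/2::real" 0 0 1] by simp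
    finally have "((\<lambda>t. (1/2) *\<^sub>R ?g t) has_integral (1/2) *\<^sub>R segment_integral \<omega> a ?c) {0..1/2}" .
    from has_integral_cmul[OF this, of 2] show ?thesis by simp
  qed
  have 2: "(?g has_integral segment_integral \<omega> ?c b) {1/2..1}"
  proof -
    have "?c + t *\<^sub>R (b - ?c) = a + ((t + 1) / 2) *\<^sub>R (b - a)" for t :: real
    proof -
      have "?c + t *\<^sub>R (b - ?c) = a + (?c - a) + t *\<^sub>R (b - ?c)" by simp
      also have "\<dots> = a + ((t + 1) / 2) *\<^sub>R (b - a)"
        unfolding half1 half2 by (simp add: add_divide_distrib scaleR_add_left)
      finally show ?thesis .
    qed
    then have "((\<lambda>t. (1/2) *\<^sub>R \<omega> (a + ((t + 1) / 2) *\<^sub>R (b - a)) (b - a)) has_integral segment_integral \<omega> ?c b) (cbox 0 1)"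
      using has_integral_segment_integral[of _ _ S \<omega>, OF sub(2) assms(2)]
      by (simp add: half2 sc)
    from has_integral_affinity[OF this, of "2::real" "-1"]
    have "((\<lambda>t. (1/2) *\<^sub>R ?g t) has_integral (1/2) *\<^sub>R segment_integral \<omega> ?c b)
            ((\<lambda>x. (1 / 2) *\<^sub>R x + -((1 / 2) *\<^sub>R (-1))) ` cbox 0 (1::real))" by simp
    also have "(\<lambda>x. (1 / 2) *\<^sub>R x + -((1 / 2) *\<^sub>R (-1))) ` cbox 0 (1::real) = {1/2..1}"
      using image_affinity_atLeastAtMost[of "1/2::real" "1/2" 0 1] by simp
    finally have "((\<lambda>t. (1/2) *\<^sub>R ?g t) has_integral (1/2) *\<^sub>R segment_integral \<omega> ?c b) {1/2..1}" .
    from has_integral_cmul[OF this, of 2] show ?thesis by simp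
  qed
  have "(?g has_integral segment_integral \<omega> a ?c + segment_integral \<omega> ?c b) {0..1}"
    by (rule has_integral_combine[OF _ _ 1 2]) auto
  then show ?thesis unfolding segment_integral_def[of \<omega> a b] by (rule integral_unique)
qed


text \<open>The fundamental theorem of calculus along the segment. In Goursat's argument it is applied to
the first-order approximation of the given form, whose triangle integrals therefore vanish.\<close>

lemma segment_integral_exact:
  fixes \<omega> :: "'a::euclidean_space \<Rightarrow> 'a \<Rightarrow> 'b::euclidean_space"
  assumes "\<And>x. x \<in> closed_segment a b \<Longrightarrow> (h has_derivative \<omega> x) (at x)"
  shows "((\<lambda>t. \<omega> (a + t *\<^sub>R (b - a)) (b - a)) has_integral h b - h a) {0..1}"
proof -
  let ?g = "\<lambda>t::real. a + t *\<^sub>R (b - a)"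
  have "((\<lambda>t. h (?g t)) has_vector_derivative \<omega> (?g t) (b - a)) (at t within {0..1})"
    if t: "t \<in> {0..1}" for t
  proof -
    have "(?g has_vector_derivative (b - a)) (at t within {0..1})"
      by (auto intro!: derivative_eq_intros)
    moreover have "(h has_derivative \<omega> (?g t)) (at (?g t) within ?g ` {0..1})"
      using assms[OF segment_point_in[OF subset_refl t]] has_derivative_at_withinI by blast
    ultimately show ?thesis
      using vector_derivative_diff_chain_within by (fastforce simp: o_def)
  qed
  then have "((\<lambda>t. \<omega> (?g t) (b - a)) has_integral h (?g 1) - h (?g 0)) {0..1}"
    by (intro fundamental_theorem_of_calculus[of 0 1 "\<lambda>t. h (?g t)"]) auto
  then show ?thesis by simp
qed

lemma has_integral_unit_interval_bound:
  fixes f :: "real \<Rightarrow> 'b::euclidean_space"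
  assumes "(f has_integral i) {0..1}" "\<And>t. t \<in> {0..1} \<Longrightarrow> norm (f t) \<le> B"
  shows "norm i \<le> B"
proof -
  have "0 \<le> B" using order_trans[OF norm_ge_zero assms(2)[of 0]] by simp
  then show ?thesis using has_integral_bound[of B f i 0 1] assms by simp
qed

definition triangle_integral ::
    "('a::euclidean_space \<Rightarrow> 'a \<Rightarrow> 'b::euclidean_space) \<Rightarrow> 'a \<Rightarrow> 'a \<Rightarrow> 'a \<Rightarrow> 'b" where
  "triangle_integral \<omega> a b c =
     segment_integral \<omega> a b + segment_integral \<omega> b c + segment_integral \<omega> c a"

text \<open>The edges of the medial triangle are each traversed twice, in opposite directions, and cancel.\<close>

lemma triangle_integral_quadrisection:
  assumes S: "convex S" and abc: "a \<in> S" "b \<in> S" "c \<in> S"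
    and cont: "\<And>v. continuous_on S (\<lambda>x. \<omega> x v)" and lin: "\<And>x. linear (\<omega> x)"
  shows "triangle_integral \<omega> a b c =
           triangle_integral \<omega> a (midpoint a b) (midpoint c a)
         + triangle_integral \<omega> (midpoint a b) b (midpoint b c)
         + triangle_integral \<omega> (midpoint c a) (midpoint b c) c
         + triangle_integral \<omega> (midpoint b c) (midpoint c a) (midpoint a b)"
proof -
  have mid: "midpoint x y \<in> S" if "x \<in> S" "y \<in> S" for x y
    using that closed_segment_subset[OF _ _ S] midpoint_in_closed_segment by blast
  have halve: "segment_integral \<omega> x y
       = segment_integral \<omega> x (midpoint x y) + segment_integral \<omega> (midpoint x y) y"
    if "x \<in> S" "y \<in> S" for x y
    by (rule segment_integral_midpoint[OF closed_segment_subset[OF that S] cont lin])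
  have rev: "segment_integral \<omega> y x = - segment_integral \<omega> x y"
    if "x \<in> S" "y \<in> S" for x y
    by (rule segment_integral_reverse[OF closed_segment_subset[OF that S] cont lin])
  show ?thesis
    unfolding triangle_integral_def
    using halve[OF abc(1,2)] halve[OF abc(2,3)] halve[OF abc(3,1)]
      rev[OF mid[OF abc(1,2)] mid[OF abc(2,3)]] rev[OF mid[OF abc(2,3)] mid[OF abc(3,1)]]
      rev[OF mid[OF abc(3,1)] mid[OF abc(1,2)]]
    by (simp add: algebra_simps)
qed

lemma dist_midpoints:
  fixes a b c :: "'a::real_normed_vector"
  shows "dist (midpoint a b) (midpoint a c) = dist b c / 2"
proof -
  have "midpoint a b - midpoint a c = (1/2) *\<^sub>R (b - c)"
    by (simp add: midpoint_def algebra_simps)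
  then show ?thesis by (simp add: dist_norm)
qed

text \<open>The diameter of a triangle is the length of its longest edge. The form needed is that every
point of the triangle sees the whole triangle within that distance.\<close>

lemma convex_hull_triangle_dist_le:
  fixes a b c :: "'a::real_normed_vector"
  assumes "dist a b \<le> d" "dist b c \<le> d" "dist c a \<le> d" "p \<in> convex hull {a, b, c}"
  shows "convex hull {a, b, c} \<subseteq> cball p d"
proof (rule hull_minimal)
  have d: "0 \<le> d" using assms(1) zero_le_dist order_trans by blast
  have "convex hull {a, b, c} \<subseteq> cball x d" if "x \<in> {a, b, c}" for x
    using that assms(1-3) d by (intro hull_minimal convex_cball) (auto simp: dist_commute)
  then show "{a, b, c} \<subseteq> cball p d"
    using assms(4) by (force simp: dist_commute)
qed simp

text \<open>Goursat's lemma. A triangle whose boundary integral has norm \<open>\<eta> > 0\<close> contains, by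
quadrisection, nested triangles with edges at most \<open>D / 2\<^sup>n\<close> and boundary integral at least
\<open>\<eta> / 4\<^sup>n\<close>. Near their common point \<open>p\<close> the form differs from an exact form by at
most \<open>\<epsilon>\<close> times the distance to \<open>p\<close>, so the boundary integral is at most
\<open>3 \<epsilon> (D / 2\<^sup>n)\<^sup>2\<close>, and this contradicts the lower bound for small \<open>\<epsilon>\<close>.\<close>

lemma triangle_integral_zero:
  fixes \<omega> :: "'a::euclidean_space \<Rightarrow> 'a \<Rightarrow> 'b::euclidean_space"
  assumes S: "convex S" and abc: "a \<in> S" "b \<in> S" "c \<in> S"
    and cont: "\<And>v. continuous_on S (\<lambda>x. \<omega> x v)" and lin: "\<And>x. linear (\<omega> x)"
    and approx: "\<And>p \<epsilon>. p \<in> S \<Longrightarrow> \<epsilon> > 0 \<Longrightarrow> \<exists>\<delta>>0. \<exists>Q q. (\<forall>x. (Q has_derivative q x) (at x)) \<and>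
        (\<forall>x\<in>S. dist x p < \<delta> \<longrightarrow> (\<forall>v. norm (\<omega> x v - q x v) \<le> \<epsilon> * dist x p * norm v))"
  shows "triangle_integral \<omega> a b c = 0"
proof (rule ccontr)
  assume nz: "triangle_integral \<omega> a b c \<noteq> 0"
  define D where "D = Max {dist a b, dist b c, dist c a}"
  define \<eta> where "\<eta> = norm (triangle_integral \<omega> a b c)"
  have \<eta>: "\<eta> > 0" using nz by (simp add: \<eta>_def)
  define bad where "bad n = (\<lambda>(x, y, z). x \<in> S \<and> y \<in> S \<and> z \<in> S \<and>
      dist x y \<le> D / 2 ^ n \<and> dist y z \<le> D / 2 ^ n \<and> dist z x \<le> D / 2 ^ n \<and>
      \<eta> / 4 ^ n \<le> norm (triangle_integral \<omega> x y z))" for n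
  define hul where "hul = (\<lambda>(x, y, z). convex hull {x, y, z :: 'a})"
  have mid: "midpoint x y \<in> S" if "x \<in> S" "y \<in> S" for x y
    using that closed_segment_subset[OF _ _ S] midpoint_in_closed_segment by blast
  have step: "\<exists>t'. bad (Suc n) t' \<and> hul t' \<subseteq> hul t" if "bad n t" for n t
  proof -
    obtain x y z where t: "t = (x, y, z)" by (cases t)
    have xyz: "x \<in> S" "y \<in> S" "z \<in> S" and
      len: "dist x y \<le> D / 2 ^ n" "dist y z \<le> D / 2 ^ n" "dist z x \<le> D / 2 ^ n" and
      big: "\<eta> / 4 ^ n \<le> norm (triangle_integral \<omega> x y z)"
      using that by (auto simp: bad_def t)
    let ?z = "midpoint x y" and ?x = "midpoint y z" and ?y = "midpoint z x"
    have m: "?x \<in> S" "?y \<in> S" "?z \<in> S" using mid xyz by auto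
    have hull_mid: "midpoint u v \<in> convex hull {x, y, z}"
      if "u \<in> {x, y, z}" "v \<in> {x, y, z}" for u v
      using that closed_segment_subset_convex_hull[of u "{x, y, z}" v]
        midpoint_in_closed_segment hull_inc by (metis (no_types, lifting) in_mono)
    have hull_sub: "convex hull {u, v, w} \<subseteq> convex hull {x, y, z}"
      if "{u, v, w} \<subseteq> {x, y, z, ?x, ?y, ?z}" for u v w
    proof (rule hull_minimal)
      have "{x, y, z, ?x, ?y, ?z} \<subseteq> convex hull {x, y, z}"
        using hull_mid hull_inc[of _ "{x, y, z}"] by auto
      then show "{u, v, w} \<subseteq> convex hull {x, y, z}" using that by blast
    qed simp
    have "norm (triangle_integral \<omega> x y z) \<le> norm (triangle_integral \<omega> x ?z ?y)
        + norm (triangle_integral \<omega> ?z y ?x) + norm (triangle_integral \<omega> ?y ?x z)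
        + norm (triangle_integral \<omega> ?x ?y ?z)"
      unfolding triangle_integral_quadrisection[OF S xyz cont lin]
      by (intro order_trans[OF norm_triangle_ineq] add_mono order_refl)
    moreover have four: "\<eta> / 4 ^ n = 4 * (\<eta> / 4 ^ Suc n)" by simp
    ultimately have "\<eta> / 4 ^ Suc n \<le> norm (triangle_integral \<omega> x ?z ?y)
        \<or> \<eta> / 4 ^ Suc n \<le> norm (triangle_integral \<omega> ?z y ?x)
        \<or> \<eta> / 4 ^ Suc n \<le> norm (triangle_integral \<omega> ?y ?x z)
        \<or> \<eta> / 4 ^ Suc n \<le> norm (triangle_integral \<omega> ?x ?y ?z)"
      using big four by linarith
    moreover have "dist x ?z \<le> D / 2 ^ Suc n" "dist ?z y \<le> D / 2 ^ Suc n"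
      "dist y ?x \<le> D / 2 ^ Suc n" "dist ?x z \<le> D / 2 ^ Suc n"
      "dist z ?y \<le> D / 2 ^ Suc n" "dist ?y x \<le> D / 2 ^ Suc n"
      using len by (simp_all add: dist_midpoint field_simps)
    moreover have "dist ?z ?y \<le> D / 2 ^ Suc n" "dist ?x ?z \<le> D / 2 ^ Suc n"
      "dist ?y ?x \<le> D / 2 ^ Suc n"
      using len dist_midpoints[of x y z] dist_midpoints[of y z x] dist_midpoints[of z x y]
      by (simp_all add: midpoint_sym dist_commute)
    ultimately have "bad (Suc n) (x, ?z, ?y) \<or> bad (Suc n) (?z, y, ?x)
        \<or> bad (Suc n) (?y, ?x, z) \<or> bad (Suc n) (?x, ?y, ?z)"
      using m xyz unfolding bad_def by (auto simp: dist_commute)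
    then show ?thesis
      using hull_sub unfolding t hul_def by (elim disjE) (force+)
  qed
  have "bad 0 (a, b, c)"
    using abc by (auto simp: bad_def D_def \<eta>_def)
  with dependent_nat_choice[of bad "\<lambda>_ t t'. hul t' \<subseteq> hul t"] step
  obtain T where T: "\<And>n. bad n (T n)" and nest: "\<And>n. hul (T (Suc n)) \<subseteq> hul (T n)"
    by metis
  have "\<Inter> (range (\<lambda>n. hul (T n))) \<noteq> {}"
  proof (rule compact_nest)
    show "compact (hul (T n))" for n
      unfolding hul_def by (cases "T n") (auto intro: finite_imp_compact_convex_hull)
    show "hul (T n) \<noteq> {}" for n
      unfolding hul_def by (cases "T n") auto
    show "hul (T n) \<subseteq> hul (T k)" if "k \<le> n" for k n
      using lift_Suc_antimono_le[of "\<lambda>n. hul (T n)", OF nest that] .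
  qed
  then obtain p where p: "\<And>n. p \<in> hul (T n)" by blast
  obtain x0 y0 z0 where T0: "T 0 = (x0, y0, z0)" by (cases "T 0")
  have "convex hull {x0, y0, z0} \<subseteq> S"
    using T[of 0] S unfolding bad_def T0 by (intro hull_minimal) auto
  then have "hul (T 0) \<subseteq> S" by (simp add: hul_def T0)
  then have pS: "p \<in> S" using p by blast
  (* the summand 1 only serves to keep the denominator positive when the triangle is a point *)
  define \<epsilon> where "\<epsilon> = \<eta> / (3 * D\<^sup>2 + 1)"
  have D2: "3 * D\<^sup>2 + 1 > 0" using zero_le_power2[of D] by linarith
  have \<epsilon>: "\<epsilon> > 0" using \<eta> D2 by (simp add: \<epsilon>_def)
  obtain \<delta> Q q where \<delta>: "\<delta> > 0" and Q: "\<And>x. (Q has_derivative q x) (at x)"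
    and close: "\<And>x v. x \<in> S \<Longrightarrow> dist x p < \<delta> \<Longrightarrow> norm (\<omega> x v - q x v) \<le> \<epsilon> * dist x p * norm v"
    using approx[OF pS \<epsilon>] by blast
  have "(\<lambda>n. D * (1/2) ^ n) \<longlonglongrightarrow> D * 0"
    by (intro tendsto_mult_left LIMSEQ_power_zero) simp
  then have "eventually (\<lambda>n. D * (1/2) ^ n < \<delta>) sequentially"
    using order_tendstoD(2) \<delta> by fastforce
  then obtain n where n: "D / 2 ^ n < \<delta>"
    by (auto simp: eventually_sequentially power_divide)
  obtain x y z where t: "T n = (x, y, z)" by (cases "T n")
  have xyz: "x \<in> S" "y \<in> S" "z \<in> S" and
    len: "dist x y \<le> D / 2 ^ n" "dist y z \<le> D / 2 ^ n" "dist z x \<le> D / 2 ^ n" and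
    big: "\<eta> / 4 ^ n \<le> norm (triangle_integral \<omega> x y z)"
    using T[of n] by (auto simp: bad_def t)
  have Kp: "convex hull {x, y, z} \<subseteq> cball p (D / 2 ^ n)"
    using convex_hull_triangle_dist_le[OF len] p[of n] by (simp add: hul_def t)
  have KS: "convex hull {x, y, z} \<subseteq> S" using xyz S by (intro hull_minimal) auto
  have side: "norm (segment_integral \<omega> u v - (Q v - Q u)) \<le> \<epsilon> * (D / 2 ^ n)\<^sup>2"
    if uv: "u \<in> {x, y, z}" "v \<in> {x, y, z}" "dist u v \<le> D / 2 ^ n" for u v
  proof -
    have seg: "closed_segment u v \<subseteq> convex hull {x, y, z}"
      using uv by (intro closed_segment_subset_convex_hull hull_inc)
    have "((\<lambda>t. \<omega> (u + t *\<^sub>R (v - u)) (v - u) - q (u + t *\<^sub>R (v - u)) (v - u))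
        has_integral segment_integral \<omega> u v - (Q v - Q u)) {0..1}"
      using has_integral_diff[OF has_integral_segment_integral[of u v S \<omega>, OF _ cont]
          segment_integral_exact[of u v Q q, OF Q]] seg KS by auto
    moreover have "norm (\<omega> (u + t *\<^sub>R (v - u)) (v - u) - q (u + t *\<^sub>R (v - u)) (v - u))
        \<le> \<epsilon> * (D / 2 ^ n)\<^sup>2" if "t \<in> {0..1}" for t :: real
    proof -
      let ?s = "u + t *\<^sub>R (v - u)"
      have s: "?s \<in> convex hull {x, y, z}"
        using segment_point_in[OF seg] that by simp
      then have "dist ?s p \<le> D / 2 ^ n" "?s \<in> S" using Kp KS by (auto simp: dist_commute)
      then have "norm (\<omega> ?s (v - u) - q ?s (v - u)) \<le> \<epsilon> * dist ?s p * norm (v - u)"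
        using close n by simp
      also have "\<dots> \<le> \<epsilon> * (D / 2 ^ n) * (D / 2 ^ n)"
        using \<epsilon> \<open>dist ?s p \<le> D / 2 ^ n\<close> uv(3) order_trans[OF zero_le_dist len(1)]
        by (intro mult_mono mult_nonneg_nonneg) (auto simp: dist_norm norm_minus_commute)
      finally show ?thesis by (simp add: power2_eq_square)
    qed
    ultimately show ?thesis by (rule has_integral_unit_interval_bound)
  qed
  have "triangle_integral \<omega> x y z = (segment_integral \<omega> x y - (Q y - Q x))
      + (segment_integral \<omega> y z - (Q z - Q y)) + (segment_integral \<omega> z x - (Q x - Q z))"
    by (simp add: triangle_integral_def)
  also have "norm \<dots> \<le> \<epsilon> * (D / 2 ^ n)\<^sup>2 + \<epsilon> * (D / 2 ^ n)\<^sup>2 + \<epsilon> * (D / 2 ^ n)\<^sup>2"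
    using len by (intro norm_triangle_mono side) auto
  also have "\<dots> = 3 * D\<^sup>2 * \<epsilon> / 4 ^ n"
    by (simp add: power_divide power2_eq_square flip: power_mult_distrib)
  also have "\<dots> < \<eta> / 4 ^ n"
  proof -
    have "3 * D\<^sup>2 * \<epsilon> < (3 * D\<^sup>2 + 1) * \<epsilon>" using \<epsilon> by (simp add: distrib_right)
    also have "\<dots> = \<eta>" using D2 by (simp add: \<epsilon>_def)
    finally show ?thesis by (simp add: divide_strict_right_mono)
  qed
  finally show False using big by simp
qed

text \<open>The primitive is the integral over the segment from a fixed point. Vanishing over triangles turns
its increments into integrals over the short segment, and continuity of the form, uniform in the
vector argument, identifies the derivative.\<close>

lemma primitive_of_triangle_integral_zero:
  fixes \<omega> :: "'a::euclidean_space \<Rightarrow> 'a \<Rightarrow> 'b::euclidean_space"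
  assumes S: "convex S" "open S" 
    and cont: "\<And>v. continuous_on S (\<lambda>x. \<omega> x v)" and lin: "\<And>x. linear (\<omega> x)"
    and ucont: "\<And>p \<epsilon>. p \<in> S \<Longrightarrow> \<epsilon> > 0 \<Longrightarrow> \<exists>\<delta>>0. \<forall>x\<in>S. dist x p < \<delta> \<longrightarrow>
        (\<forall>v. norm (\<omega> x v - \<omega> p v) \<le> \<epsilon> * norm v)"
    and zero: "\<And>a b c. a \<in> S \<Longrightarrow> b \<in> S \<Longrightarrow> c \<in> S \<Longrightarrow> triangle_integral \<omega> a b c = 0"
  shows "\<exists>h. \<forall>x\<in>S. (h has_derivative \<omega> x) (at x)"
proof (cases "S = {}")
  case False
  then obtain c where c: "c \<in> S" by blast
  have "(segment_integral \<omega> c has_derivative \<omega> x) (at x)" if x: "x \<in> S" for x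
    unfolding has_derivative_within_alt
  proof (intro conjI allI impI)
    show "bounded_linear (\<omega> x)" using lin linear_conv_bounded_linear by blast
    fix \<epsilon> :: real assume \<epsilon>: "\<epsilon> > 0"
    obtain \<delta> where \<delta>: "\<delta> > 0"
      and close: "\<And>z v. z \<in> S \<Longrightarrow> dist z x < \<delta> \<Longrightarrow> norm (\<omega> z v - \<omega> x v) \<le> \<epsilon> * norm v"
      using ucont[OF x \<epsilon>] by blast
    obtain r where r: "r > 0" "ball x r \<subseteq> S" using S(2) x open_contains_ball by blast
    show "\<exists>d>0. \<forall>y\<in>UNIV. norm (y - x) < d \<longrightarrow>
        norm (segment_integral \<omega> c y - segment_integral \<omega> c x - \<omega> x (y - x)) \<le> \<epsilon> * norm (y - x)"
    proof (intro exI[of _ "min \<delta> r"] conjI ballI impI)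
      show "min \<delta> r > 0" using \<delta> r by simp
      fix y assume y: "norm (y - x) < min \<delta> r"
      then have yS: "y \<in> S" using r by (auto simp: dist_norm norm_minus_commute subset_iff)
      have "segment_integral \<omega> y c = - segment_integral \<omega> c y"
        by (rule segment_integral_reverse[OF closed_segment_subset[OF c yS S(1)] cont lin])
      then have diff: "segment_integral \<omega> c y - segment_integral \<omega> c x = segment_integral \<omega> x y"
        using zero[OF c x yS] unfolding triangle_integral_def
        by (simp add: algebra_simps) 
      have "((\<lambda>t. \<omega> (x + t *\<^sub>R (y - x)) (y - x) - \<omega> x (y - x)) has_integral
            segment_integral \<omega> x y - \<omega> x (y - x)) {0..1}"
        using has_integral_diff[OF has_integral_segment_integral[of x y S \<omega>,
            OF closed_segment_subset[OF x yS S(1)] cont] has_integral_const_real[of "\<omega> x (y - x)" 0 1]]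
        by simp
      moreover have "norm (\<omega> (x + t *\<^sub>R (y - x)) (y - x) - \<omega> x (y - x)) \<le> \<epsilon> * norm (y - x)"
        if t: "t \<in> {0..1}" for t :: real
      proof (rule close)
        show "x + t *\<^sub>R (y - x) \<in> S"
          using segment_point_in[OF closed_segment_subset[OF x yS S(1)]] t by simp
        have "norm (t *\<^sub>R (y - x)) \<le> 1 * norm (y - x)"
          using t by (simp add: mult_left_le_one_le)
        then show "dist (x + t *\<^sub>R (y - x)) x < \<delta>" using y by (simp add: dist_norm)
      qed
      ultimately show "norm (segment_integral \<omega> c y - segment_integral \<omega> c x - \<omega> x (y - x))
          \<le> \<epsilon> * norm (y - x)"
        unfolding diff by (rule has_integral_unit_interval_bound)
    qed
  qed
  then show ?thesis by blast
qed simp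


text \<open>At a point \<open>p\<close> the form \<open>v \<mapsto> m (f x) v\<close> agrees up to first order with
\<open>v \<mapsto> m (f p) v + m (f' p (x - p)) v\<close>. By the symmetry assumption the latter is the
derivative of \<open>m (f p) x + m (f' p (x - p)) (x - p) / 2\<close>. This is the Poincare lemma for
closed one-forms with values in a Euclidean space, for forms that are merely differentiable.\<close>

lemma symmetric_derivative_imp_primitive:
  fixes f :: "'a::euclidean_space \<Rightarrow> 'c::real_normed_vector"
    and m :: "'c \<Rightarrow> 'a \<Rightarrow> 'b::euclidean_space"
  assumes m: "bounded_bilinear m" and S: "convex S" "open S"
    and f: "\<And>x. x \<in> S \<Longrightarrow> (f has_derivative f' x) (at x)"
    and sym: "\<And>x u v. x \<in> S \<Longrightarrow> m (f' x u) v = m (f' x v) u"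
  shows "\<exists>h. \<forall>x\<in>S. (h has_derivative m (f x)) (at x)"
proof -
  interpret bounded_bilinear m by (rule m)
  obtain K where K: "K > 0" "\<And>a b. norm (m a b) \<le> norm a * norm b * K"
    using pos_bounded by blast
  have small: "norm (m a v) \<le> \<epsilon> * norm v" if "norm a \<le> \<epsilon> / K" for a v \<epsilon>
  proof -
    have "norm (m a v) \<le> norm a * norm v * K" by (rule K)
    also have "\<dots> \<le> \<epsilon> / K * norm v * K" using that K(1) by (intro mult_right_mono) auto
    finally show ?thesis using K(1) by simp
  qed
  have contf: "continuous_on S f"
    using f has_derivative_continuous by (fastforce intro: continuous_at_imp_continuous_on)
  have cont: "continuous_on S (\<lambda>x. m (f x) v)" for v
    by (intro continuous_on contf continuous_on_const)
  have lin: "linear (m c)" for c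
    using bounded_linear_right linear_conv_bounded_linear by blast
  show ?thesis
  proof (rule primitive_of_triangle_integral_zero[OF S cont lin])
    fix p and \<epsilon> :: real assume p: "p \<in> S" and \<epsilon>: "\<epsilon> > 0"
    then obtain \<delta> where "\<delta> > 0" "\<And>x. x \<in> S \<Longrightarrow> dist x p < \<delta> \<Longrightarrow> dist (f x) (f p) < \<epsilon> / K"
      using contf K(1) unfolding continuous_on_iff by (metis divide_pos_pos)
    then show "\<exists>\<delta>>0. \<forall>x\<in>S. dist x p < \<delta> \<longrightarrow> (\<forall>v. norm (m (f x) v - m (f p) v) \<le> \<epsilon> * norm v)"
      using small by (metis diff_left dist_norm less_imp_le)
  next
    fix a b c assume abc: "a \<in> S" "b \<in> S" "c \<in> S"
    show "triangle_integral (\<lambda>x. m (f x)) a b c = 0"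
    proof (rule triangle_integral_zero[OF S(1) abc cont lin])
      fix p and \<epsilon> :: real assume p: "p \<in> S" and \<epsilon>: "\<epsilon> > 0"
      define Q where "Q x = m (f p) x + (1/2) *\<^sub>R m (f' p (x - p)) (x - p)" for x
      define q where "q x v = m (f p) v + m (f' p (x - p)) v" for x v
      have f'_bl: "bounded_linear (f' p)" using f[OF p] has_derivative_bounded_linear by blast
      have "(Q has_derivative q x) (at x)" for x
      proof -
        have "((\<lambda>x. f' p (x - p)) has_derivative f' p) (at x)"
          by (intro bounded_linear.has_derivative[OF f'_bl]) (auto intro!: derivative_eq_intros)
        then have 1: "((\<lambda>x. m (f' p (x - p)) (x - p)) has_derivative
            (\<lambda>v. m (f' p (x - p)) v + m (f' p v) (x - p))) (at x)"
          by (rule FDERIV) (auto intro!: derivative_eq_intros)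
        have "(Q has_derivative (\<lambda>v. m (f p) v +
            (1/2) *\<^sub>R (m (f' p (x - p)) v + m (f' p v) (x - p)))) (at x)"
          unfolding Q_def
          by (intro has_derivative_add has_derivative_scaleR_right 1
              bounded_linear_imp_has_derivative bounded_linear_right)
        moreover have "(1/2) *\<^sub>R (m (f' p (x - p)) v + m (f' p v) (x - p)) = m (f' p (x - p)) v" for v
          unfolding sym[OF p, of v "x - p"] by (simp flip: scaleR_2)
        ultimately show ?thesis unfolding q_def by simp
      qed
      moreover obtain \<delta> where "\<delta> > 0" and
        \<delta>: "\<And>x. norm (x - p) < \<delta> \<Longrightarrow> norm (f x - f p - f' p (x - p)) \<le> \<epsilon> / K * norm (x - p)"
        using f[OF p] K(1) \<epsilon> unfolding has_derivative_within_alt by (metis UNIV_I divide_pos_pos)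
      moreover have "norm (m (f x) v - q x v) \<le> \<epsilon> * dist x p * norm v" if "dist x p < \<delta>" for x v
      proof -
        have "m (f x) v - q x v = m (f x - f p - f' p (x - p)) v"
          by (simp add: q_def diff_left)
        then show ?thesis
          using small[of "f x - f p - f' p (x - p)" "\<epsilon> * dist x p" v] \<delta>[of x] that
          by (simp add: dist_norm)
      qed
      ultimately show "\<exists>\<delta>>0. \<exists>Q q. (\<forall>x. (Q has_derivative q x) (at x)) \<and>
          (\<forall>x\<in>S. dist x p < \<delta> \<longrightarrow> (\<forall>v. norm (m (f x) v - q x v) \<le> \<epsilon> * dist x p * norm v))"
        by blast
    qed
  qed
qed

section \<open>Inversion in a commutative algebra\<close>

locale R3_algebra =
  fixes m :: "real^3 \<Rightarrow> real^3 \<Rightarrow> real^3" and e :: "real^3"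
  assumes algebra: "algebra_on_R3 m e"
begin

sublocale bounded_bilinear m
  using algebra by (simp add: algebra_on_R3_def flip: bilinear_conv_bounded_bilinear)

lemma assoc: "m (m x y) z = m x (m y z)"
  and comm: "m x y = m y x"
  and unit_left: "m e x = x"
  using algebra unfolding algebra_on_R3_def by auto

lemma unit_right: "m x e = x"
  using comm unit_left by metis

lemma left_comm: "m x (m y z) = m y (m x z)"
  using assoc comm by metis

lemma linear_mult: "linear (m x)"
  using bounded_linear_right linear_conv_bounded_linear by blast

lemma alg_inverse_eqI:
  assumes "m a b = e"
  shows "alg_inverse m e a = b"
  unfolding alg_inverse_def
proof (rule the_equality)
  show "m a b = e" by (rule assms)
  fix c assume "m a c = e"
  then show "c = b" using assms by (metis assoc comm unit_left)
qed

lemma mult_alg_inverse: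
  assumes "a \<in> regular_elements m e"
  shows "m a (alg_inverse m e a) = e"
  using assms alg_inverse_eqI unfolding regular_elements_def by auto

text \<open>With \<open>b\<close> the inverse of \<open>a\<close>, one has \<open>x = b (y x) + b ((a - y) x)\<close>, and for \<open>y\<close>
close to \<open>a\<close> the second term has norm at most half that of \<open>x\<close>. The bound yields both
the regularity of the neighbours of \<open>a\<close> and a uniform bound for their inverses.\<close>

lemma mult_bounded_below_near_regular:
  assumes "a \<in> regular_elements m e"
  obtains \<delta> C where "\<delta> > 0" "\<And>x y. dist y a < \<delta> \<Longrightarrow> norm x \<le> C * norm (m y x)"
proof -
  define b where "b = alg_inverse m e a"
  have ab: "m a b = e" using mult_alg_inverse[OF assms] by (simp add: b_def)
  obtain K where K: "K > 0" "\<And>x y. norm (m x y) \<le> norm x * norm y * K"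
    using pos_bounded by blast
  define L where "L = K\<^sup>2 * norm b"
  have L: "L \<ge> 0" by (simp add: L_def)
  define \<delta> where "\<delta> = 1 / (2 * L + 1)"
  have \<delta>: "\<delta> > 0" using L by (simp add: \<delta>_def)
  have "L * \<delta> \<le> 1 / 2" using L by (simp add: \<delta>_def field_simps)
  have "norm x \<le> (2 * K * norm b) * norm (m y x)" if "dist y a < \<delta>" for x y
  proof -
    have "x = m b (m a x)" using ab assoc comm unit_left by metis
    also have "\<dots> = m b (m y x) + m b (m (a - y) x)" by (simp add: diff_left diff_right)
    finally have "norm x \<le> norm (m b (m y x)) + norm (m b (m (a - y) x))"
      using norm_triangle_ineq by metis
    also have "norm (m b (m y x)) \<le> K * norm b * norm (m y x)"
      using K(2)[of b "m y x"] by (simp add: mult_ac)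
    also have "norm (m b (m (a - y) x)) \<le> norm b * norm (m (a - y) x) * K" by (rule K)
    also have "norm b * norm (m (a - y) x) * K \<le> norm b * (norm (a - y) * norm x * K) * K"
      using K by (intro mult_left_mono mult_right_mono) auto
    also have "\<dots> = L * norm (a - y) * norm x"
      by (simp add: L_def power2_eq_square mult_ac)
    also have "\<dots> \<le> L * \<delta> * norm x"
      using that L by (intro mult_left_mono mult_right_mono) (auto simp: dist_norm norm_minus_commute)
    also have "\<dots> \<le> 1 / 2 * norm x"
      using \<open>L * \<delta> \<le> 1 / 2\<close> by (intro mult_right_mono) auto
    finally show ?thesis by simp
  qed
  with \<delta> show ?thesis using that by blast
qed

lemma open_regular_elements: "open (regular_elements m e)"
  unfolding open_dist
proof
  fix a assume "a \<in> regular_elements m e"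
  then obtain \<delta> C where \<delta>: "\<delta> > 0" "\<And>x y. dist y a < \<delta> \<Longrightarrow> norm x \<le> C * norm (m y x)"
    using mult_bounded_below_near_regular by blast
  have "y \<in> regular_elements m e" if "dist y a < \<delta>" for y
  proof -
    have "inj (m y)"
      unfolding linear_injective_0[OF linear_mult]
    proof (intro allI impI)
      fix x assume "m y x = 0"
      then show "x = 0" using \<delta>(2)[OF that, of x] by simp
    qed
    then have "surj (m y)" using linear_injective_imp_surjective[OF linear_mult] by simp
    then show ?thesis unfolding regular_elements_def by (metis (mono_tags) mem_Collect_eq surjD)
  qed
  with \<delta>(1) show "\<exists>\<delta>>0. \<forall>y. dist y a < \<delta> \<longrightarrow> y \<in> regular_elements m e" by blast
qed

text \<open>With \<open>b\<close> and \<open>z\<close> the inverses of \<open>a\<close> and \<open>y\<close>, and \<open>w = b (a - y)\<close>, one has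
\<open>z - b = z w\<close>, and therefore the error of the linear approximation is \<open>z w w\<close>, which
is quadratic in \<open>a - y\<close> because \<open>z\<close> stays bounded.\<close>

lemma has_derivative_alg_inverse:
  assumes "a \<in> regular_elements m e"
  defines "b \<equiv> alg_inverse m e a"
  shows "(alg_inverse m e has_derivative (\<lambda>v. - m (m b b) v)) (at a)"
proof -
  have ab: "m a b = e" using mult_alg_inverse[OF assms(1)] by (simp add: b_def)
  obtain K where K: "K > 0" "\<And>x y. norm (m x y) \<le> norm x * norm y * K"
    using pos_bounded by blast
  obtain \<delta>1 C where \<delta>1: "\<delta>1 > 0" "\<And>x y. dist y a < \<delta>1 \<Longrightarrow> norm x \<le> C * norm (m y x)"
    using mult_bounded_below_near_regular[OF assms(1)] by blast
  obtain \<delta>2 where \<delta>2: "\<delta>2 > 0" "\<And>y. dist y a < \<delta>2 \<Longrightarrow> y \<in> regular_elements m e"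
    using open_regular_elements assms(1) unfolding open_dist by blast
  define B where "B = C * norm e"
  define N where "N = B * (norm b * K)\<^sup>2 * K\<^sup>2"
  show ?thesis
  proof (rule has_derivativeI_sandwich[where e = "min \<delta>1 \<delta>2" and H = "\<lambda>y. N * norm (y - a)"])
    show "0 < min \<delta>1 \<delta>2" using \<delta>1 \<delta>2 by simp
    show "bounded_linear (\<lambda>v. - m (m b b) v)"
      by (intro bounded_linear_minus bounded_linear_right)
    have "((\<lambda>y. N * norm (y - a)) \<longlongrightarrow> N * norm (a - a)) (at a)" by (intro tendsto_intros)
    then show "((\<lambda>y. N * norm (y - a)) \<longlongrightarrow> 0) (at a)" by simp
    fix y assume y: "y \<noteq> a" "dist y a < min \<delta>1 \<delta>2"
    define z where "z = alg_inverse m e y"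
    have yz: "m y z = e" using mult_alg_inverse \<delta>2 y by (simp add: z_def)
    have z: "norm z \<le> B" using \<delta>1(2)[of y z] y yz by (simp add: B_def)
    then have B: "0 \<le> B" by (rule order_trans[OF norm_ge_zero])
    define w where "w = m b (a - y)"
    have zab: "m z (m b a) = z" using ab comm unit_right by metis
    have zby: "m z (m b y) = b" using yz comm left_comm unit_right by metis
    have zw: "m z w = z - b" unfolding w_def by (simp only: diff_right zab zby)
    have "z - b - - m (m b b) (y - a) = m (z - b) w"
      unfolding w_def by (simp add: diff_left diff_right assoc zab zby)
    also have "\<dots> = m z (m w w)" by (simp add: zw[symmetric] assoc)
    finally have "norm (z - b - - m (m b b) (y - a)) \<le> norm z * norm (m w w) * K"
      using K(2) by simp
    also have "\<dots> \<le> B * (norm w * norm w * K) * K"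
      using K z B by (intro mult_mono mult_nonneg_nonneg) auto
    also have "\<dots> \<le> B * ((norm b * norm (a - y) * K) * (norm b * norm (a - y) * K) * K) * K"
      using K B unfolding w_def
      by (intro mult_mono mult_nonneg_nonneg order_refl) auto
    also have "\<dots> = N * norm (y - a) * norm (y - a)"
      by (simp add: N_def power2_eq_square mult_ac norm_minus_commute)
    finally show "norm (alg_inverse m e y - alg_inverse m e a - - m (m b b) (y - a)) / norm (y - a)
        \<le> N * norm (y - a)"
      using y(1) by (simp add: z_def b_def divide_le_eq)
  qed
qed

end

section \<open>Local primitives of the inverse field\<close>

locale algebrizable_field = R3_algebra +
  fixes F :: "real^3 \<Rightarrow> real^3" and \<Omega> :: "(real^3) set"
  assumes open_domain: "open \<Omega>" and algebrizable: "algebrizable_on m F \<Omega>"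
begin

abbreviation R where "R \<equiv> regular_domain m e F \<Omega>"

abbreviation \<phi> where "\<phi> x \<equiv> alg_inverse m e (F x)"

lemma algebra_derivative:
  obtains F' where "\<And>w. w \<in> \<Omega> \<Longrightarrow> (F has_derivative m (F' w)) (at w)"
  using algebrizable bounded_linear_right unfolding algebrizable_on_def has_derivative_at by blast

lemma open_regular_domain: "open R"
proof -
  have "continuous_on \<Omega> F"
    using algebra_derivative has_derivative_continuous
    by (metis continuous_at_imp_continuous_on)
  then have "open (\<Omega> \<inter> F -` regular_elements m e)"
    using continuous_open_preimage open_domain open_regular_elements by blast
  also have "\<Omega> \<inter> F -` regular_elements m e = R" by (auto simp: regular_domain_def)
  finally show ?thesis .
qed

text \<open>The derivative of \<open>e/F\<close> is multiplication by \<open>- F' / F\<^sup>2\<close>, so commutativity and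
associativity give the symmetry required for a primitive.\<close>

lemma local_primitive:
  assumes "convex S" "open S" "S \<subseteq> R"
  obtains h where "\<And>x. x \<in> S \<Longrightarrow> (h has_derivative m (\<phi> x)) (at x)"
proof -
  obtain F' where F': "\<And>w. w \<in> \<Omega> \<Longrightarrow> (F has_derivative m (F' w)) (at w)"
    using algebra_derivative by blast
  have "\<exists>h. \<forall>x\<in>S. (h has_derivative m (\<phi> x)) (at x)"
  proof (rule symmetric_derivative_imp_primitive[OF bounded_bilinear_axioms assms(1,2)])
    fix x assume "x \<in> S"
    then have "x \<in> \<Omega>" "F x \<in> regular_elements m e"
      using assms(3) by (auto simp: regular_domain_def)
    then show "(\<phi> has_derivative (\<lambda>v. - m (m (\<phi> x) (\<phi> x)) (m (F' x) v))) (at x)"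
      using has_derivative_compose[OF F' has_derivative_alg_inverse] by blast
    show "m (- m (m (\<phi> x) (\<phi> x)) (m (F' x) u)) v = m (- m (m (\<phi> x) (\<phi> x)) (m (F' x) v)) u" for u v
      by (simp add: minus_left assoc comm[of u v])
  qed
  then show ?thesis using that by blast
qed

end

section \<open>Curves at rest outside an interval\<close>

text \<open>The curves are defined on the whole line and constant outside \<open>[0, a]\<close>, so that the
velocity vanishes at both ends and joining two of them does not create corners.\<close>

definition rest_curve ::
    "(real^3) set \<Rightarrow> real \<Rightarrow> (real \<Rightarrow> real^3) \<Rightarrow> real^3 \<Rightarrow> real^3 \<Rightarrow> bool" where
  "rest_curve S a \<gamma> p q \<longleftrightarrow>
     0 < a \<and> (\<forall>t. \<gamma> t \<in> S) \<and> (\<forall>t. \<gamma> differentiable (at t)) \<and>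
     (\<forall>t\<le>0. \<gamma> t = p) \<and> (\<forall>t\<ge>a. \<gamma> t = q)"

lemma rest_curve_imp_differentiable_curve:
  "rest_curve S a \<gamma> p q \<Longrightarrow> differentiable_curve S a \<gamma> p q"
  unfolding rest_curve_def differentiable_curve_def
  by (auto intro: differentiable_at_withinI)

lemma rest_curve_has_curve_integral_iff:
  assumes "rest_curve S a \<gamma> p q"
  shows "has_curve_integral m e F a \<gamma> I \<longleftrightarrow>
    ((\<lambda>t. m (alg_inverse m e (F (\<gamma> t))) (vector_derivative \<gamma> (at t))) has_integral I) {0..a}"
  unfolding has_curve_integral_def
proof (rule has_integral_cong)
  fix t assume t: "t \<in> {0..a}"
  have "(\<gamma> has_vector_derivative vector_derivative \<gamma> (at t)) (at t)"
    using assms vector_derivative_works unfolding rest_curve_def by blast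
  then have "vector_derivative \<gamma> (at t within {0..a}) = vector_derivative \<gamma> (at t)"
    using t assms unfolding rest_curve_def by (intro vector_derivative_at_within_ivl) auto
  then show "m (alg_inverse m e (F (\<gamma> t))) (vector_derivative \<gamma> (at t within {0..a}))
      = m (alg_inverse m e (F (\<gamma> t))) (vector_derivative \<gamma> (at t))" by simp
qed

text \<open>At every time one of the two curves rests at \<open>q\<close>, so their sum minus \<open>q\<close> runs through the
one and then through the other; as a sum of differentiable curves it is differentiable.\<close>

lemma rest_curve_join:
  assumes \<gamma>: "rest_curve S a \<gamma> p q" and \<delta>: "rest_curve S b \<delta> q r"
    and I: "has_curve_integral m e F a \<gamma> I" and J: "has_curve_integral m e F b \<delta> J"
  defines "\<eta> \<equiv> \<lambda>t. \<gamma> t + \<delta> (t - a) - q"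
  shows "rest_curve S (a + b) \<eta> p r" "has_curve_integral m e F (a + b) \<eta> (I + J)"
proof -
  have ab: "0 < a" "0 < b" using \<gamma> \<delta> by (auto simp: rest_curve_def)
  have left: "\<eta> t = \<gamma> t" if "t \<le> a" for t
    using \<delta> that by (simp add: \<eta>_def rest_curve_def)
  have right: "\<eta> t = \<delta> (t - a)" if "a \<le> t" for t
    using \<gamma> that by (simp add: \<eta>_def rest_curve_def)
  have D\<gamma>: "(\<gamma> has_vector_derivative vector_derivative \<gamma> (at t)) (at t)"
    and D\<delta>: "(\<delta> has_vector_derivative vector_derivative \<delta> (at t)) (at t)" for t
    using \<gamma> \<delta> vector_derivative_works unfolding rest_curve_def by blast+
  have shift: "((\<lambda>t. \<delta> (t - a)) has_vector_derivative vector_derivative \<delta> (at (t - a))) (at t)" for t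
  proof -
    have "((\<lambda>t. t - a) has_vector_derivative 1) (at t)"
      by (auto intro!: derivative_eq_intros)
    from vector_diff_chain_at[OF this D\<delta>[of "t - a"]] show ?thesis by (simp add: o_def)
  qed
  have "\<eta> differentiable (at t)" for t
    unfolding \<eta>_def using D\<gamma> shift
    by (intro derivative_intros) (auto intro: differentiableI_vector)
  moreover have "\<eta> t \<in> S" for t
    using left[of t] right[of t] \<gamma> \<delta> by (cases "t \<le> a") (auto simp: rest_curve_def)
  ultimately show rc: "rest_curve S (a + b) \<eta> p r"
    using left right \<gamma> \<delta> ab unfolding rest_curve_def by simp
  have vd_left: "vector_derivative \<eta> (at t) = vector_derivative \<gamma> (at t)" if "t < a" for t
    using has_vector_derivative_transform_within_open[OF D\<gamma>, of "{..<a}" t \<eta>] left that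
    by (intro vector_derivative_at) auto
  have vd_right: "vector_derivative \<eta> (at t) = vector_derivative \<delta> (at (t - a))" if "a < t" for t
    using has_vector_derivative_transform_within_open[OF shift, of "{a<..}" t \<eta>] right that
    by (intro vector_derivative_at) auto
  let ?f = "\<lambda>\<gamma> t. m (alg_inverse m e (F (\<gamma> t))) (vector_derivative \<gamma> (at t))"
  have "(?f \<gamma> has_integral I) {0..a}"
    using I rest_curve_has_curve_integral_iff[OF \<gamma>] by blast
  then have 1: "(?f \<eta> has_integral I) {0..a}"
    by (rule has_integral_spike_finite[of "{a}", rotated -1]) (auto simp: left vd_left)
  have "(?f \<delta> has_integral J) (cbox 0 b)"
    using J rest_curve_has_curve_integral_iff[OF \<delta>] by simp
  from has_integral_affinity'[OF this, of 1 "-a"]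
  have "((\<lambda>t. ?f \<delta> (t - a)) has_integral J) {a..a + b}"
    by (simp add: add.commute)
  then have 2: "(?f \<eta> has_integral J) {a..a + b}"
    by (rule has_integral_spike_finite[of "{a}", rotated -1]) (auto simp: right vd_right)
  have "(?f \<eta> has_integral I + J) {0..a + b}"
    using has_integral_combine[OF _ _ 1 2] ab by simp
  then show "has_curve_integral m e F (a + b) \<eta> (I + J)"
    using rest_curve_has_curve_integral_iff[OF rc] by blast
qed

lemma has_real_derivative_max_square:
  "((\<lambda>t::real. (max 0 t)\<^sup>2) has_real_derivative 2 * max 0 t) (at t)"
proof -
  consider "t < 0" | "t > 0" | "t = 0" by linarith
  then show ?thesis
  proof cases
    case 1
    have "((\<lambda>t::real. 0) has_real_derivative 0) (at t)" by simp
    then have "((\<lambda>t::real. (max 0 t)\<^sup>2) has_real_derivative 0) (at t)"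
      by (rule has_field_derivative_transform_within_open[of _ _ _ "{..<0}"]) (use 1 in auto)
    then show ?thesis using 1 by simp
  next
    case 2
    have "((\<lambda>t::real. t\<^sup>2) has_real_derivative 2 * t) (at t)"
      by (auto intro!: derivative_eq_intros)
    then have "((\<lambda>t::real. (max 0 t)\<^sup>2) has_real_derivative 2 * t) (at t)"
      by (rule has_field_derivative_transform_within_open[of _ _ _ "{0<..}"]) (use 2 in auto)
    then show ?thesis using 2 by simp
  next
    case 3
    have "(\<lambda>h::real. (max 0 h)\<^sup>2 / h) \<midarrow>0\<rightarrow> 0"
    proof (rule Lim_null_comparison)
      show "\<forall>\<^sub>F h in at 0. norm ((max 0 h)\<^sup>2 / h) \<le> \<bar>h\<bar>" for h :: real
        by (rule always_eventually) (auto simp: max_def power2_eq_square)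
      show "(\<lambda>h::real. \<bar>h\<bar>) \<midarrow>0\<rightarrow> 0"
        by (rule tendsto_rabs_zero) (rule tendsto_ident_at)
    qed
    then show ?thesis unfolding DERIV_def 3 by simp
  qed
qed

text \<open>The continuously differentiable quadratic spline that rises from \<open>0\<close> to \<open>1\<close> over
\<open>[0, 1]\<close>: its second derivative is \<open>4\<close> on the first half and \<open>-4\<close> on the second.\<close>

definition smooth_step :: "real \<Rightarrow> real" where
  "smooth_step t = 2 * ((max 0 t)\<^sup>2 - 2 * (max 0 (t - 1/2))\<^sup>2 + (max 0 (t - 1))\<^sup>2)"

lemma smooth_step_differentiable: "smooth_step differentiable (at t)"
proof -
  have "((\<lambda>t::real. (max 0 (t - c))\<^sup>2) has_real_derivative 2 * max 0 (t - c)) (at t)" for c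
    using DERIV_chain2[OF has_real_derivative_max_square, of "\<lambda>t. t - c" 1 t UNIV]
      DERIV_diff[OF DERIV_ident DERIV_const[of c], of t UNIV] by simp
  then have "(\<lambda>t::real. (max 0 (t - c))\<^sup>2) differentiable (at t)" for c
    using real_differentiable_def by blast
  from this[of 0] this[of "1/2"] this[of 1] show ?thesis
    unfolding smooth_step_def[abs_def]
    by (intro differentiable_mult differentiable_add differentiable_diff differentiable_const) auto
qed

lemma smooth_step_bounds: "smooth_step t \<in> {0..1}"
  and smooth_step_0: "t \<le> 0 \<Longrightarrow> smooth_step t = 0"
  and smooth_step_1: "1 \<le> t \<Longrightarrow> smooth_step t = 1"
proof -
  show 0: "smooth_step t = 0" if "t \<le> 0"
    using that by (simp add: smooth_step_def)
  show 1: "smooth_step t = 1" if "1 \<le> t"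
    using that by (simp add: smooth_step_def max_def power2_eq_square algebra_simps)
  have half1: "smooth_step t = 2 * t\<^sup>2" if "0 \<le> t" "t \<le> 1/2"
    using that by (simp add: smooth_step_def)
  have half2: "smooth_step t = 1 - 2 * (1 - t)\<^sup>2" if "1/2 \<le> t" "t \<le> 1"
    using that by (simp add: smooth_step_def power2_eq_square algebra_simps)
  have sq: "2 * x\<^sup>2 \<le> 1" if "0 \<le> x" "x \<le> 1/2" for x :: real
    using power_mono[OF that(2,1), of 2] by (simp add: power2_eq_square)
  consider "t \<le> 0" | "0 \<le> t" "t \<le> 1/2" | "1/2 \<le> t" "t \<le> 1" | "1 \<le> t" by linarith
  then show "smooth_step t \<in> {0..1}"
  proof cases
    case 2 then show ?thesis using half1 sq[of t] by simp
  next
    case 3 then show ?thesis using half2 sq[of "1 - t"] by simp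
  qed (use 0 1 in auto)
qed

lemma rest_curve_segment:
  assumes "closed_segment p q \<subseteq> S"
  shows "rest_curve S 1 (\<lambda>t. p + smooth_step t *\<^sub>R (q - p)) p q"
  unfolding rest_curve_def
  using segment_point_in[OF assms smooth_step_bounds] smooth_step_0 smooth_step_1
  by (auto intro!: derivative_intros smooth_step_differentiable)

section \<open>Local branches of the curve integral\<close>

context algebrizable_field
begin

lemma primitive_imp_curve_integral:
  assumes h: "\<And>x. x \<in> S \<Longrightarrow> (h has_derivative m (\<phi> x)) (at x)"
    and \<gamma>: "differentiable_curve S a \<gamma> p q"
  shows "has_curve_integral m e F a \<gamma> (h q - h p)"
proof -
  let ?v = "\<lambda>t. vector_derivative \<gamma> (at t within {0..a})"
  have "((\<lambda>t. h (\<gamma> t)) has_vector_derivative m (\<phi> (\<gamma> t)) (?v t)) (at t within {0..a})"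
    if t: "t \<in> {0..a}" for t
  proof -
    have "(\<gamma> has_vector_derivative ?v t) (at t within {0..a})" and "\<gamma> t \<in> S"
      using \<gamma> t vector_derivative_works unfolding differentiable_curve_def by blast+
    moreover have "(h has_derivative m (\<phi> (\<gamma> t))) (at (\<gamma> t) within \<gamma> ` {0..a})"
      using h[OF \<open>\<gamma> t \<in> S\<close>] has_derivative_at_withinI by blast
    ultimately show ?thesis
      using vector_derivative_diff_chain_within by (fastforce simp: o_def)
  qed
  then have "((\<lambda>t. m (\<phi> (\<gamma> t)) (?v t)) has_integral h (\<gamma> a) - h (\<gamma> 0)) {0..a}"
    using \<gamma> unfolding differentiable_curve_def
    by (intro fundamental_theorem_of_calculus[of 0 a "\<lambda>t. h (\<gamma> t)"]) auto
  then show ?thesis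
    using \<gamma> unfolding has_curve_integral_def differentiable_curve_def by auto
qed

lemma ball_in_regular_domain:
  assumes "w \<in> U" "open U" "U \<subseteq> R"
  obtains r h where "r > 0" "ball w r \<subseteq> U"
    "\<And>x. x \<in> ball w r \<Longrightarrow> (h has_derivative m (\<phi> x)) (at x)"
proof -
  obtain r where "r > 0" "ball w r \<subseteq> U" using assms open_contains_ball by blast
  then show ?thesis
    using local_primitive[OF convex_ball open_ball, of w r] assms(3) that by (metis order_trans)
qed

lemma rest_curve_in_ball:
  assumes h: "\<And>x. x \<in> ball w r \<Longrightarrow> (h has_derivative m (\<phi> x)) (at x)"
    and S: "ball w r \<subseteq> S" and pq: "p \<in> ball w r" "q \<in> ball w r"
  obtains a \<gamma> where "rest_curve S a \<gamma> p q" "has_curve_integral m e F a \<gamma> (h q - h p)"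
proof -
  have seg: "closed_segment p q \<subseteq> ball w r" using pq closed_segment_subset convex_ball by blast
  show ?thesis
  proof (rule that)
    show "rest_curve S 1 (\<lambda>t. p + smooth_step t *\<^sub>R (q - p)) p q"
      using rest_curve_segment seg S by blast
    show "has_curve_integral m e F 1 (\<lambda>t. p + smooth_step t *\<^sub>R (q - p)) (h q - h p)"
      using primitive_imp_curve_integral[OF h rest_curve_imp_differentiable_curve]
        rest_curve_segment[OF seg] by blast
  qed
qed

text \<open>Within a ball any two points are joined by a rest curve, and such a curve can be appended to one
that starts at \<open>p\<close>. Hence being reached from \<open>p\<close> is locally constant, and the
component is connected. The integral over the joined curve exists because the ball
carries a primitive.\<close>

lemma rest_curve_in_component:
  assumes "C \<in> components R" "p \<in> C" "q \<in> C"
  shows "\<exists>a \<gamma> I. rest_curve R a \<gamma> p q \<and> has_curve_integral m e F a \<gamma> I"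
proof (rule connected_induction_simple[where S = C and a = p and b = q])
  have CR: "C \<subseteq> R" "open C"
    using assms(1) in_components_subset open_components open_regular_domain by blast+
  show "connected C" "p \<in> C" "q \<in> C" using assms in_components_connected by blast+
  obtain r h where "r > 0" "ball p r \<subseteq> R"
      "\<And>x. x \<in> ball p r \<Longrightarrow> (h has_derivative m (\<phi> x)) (at x)"
    using ball_in_regular_domain[OF assms(2) CR(2,1)] CR(1) by (metis order_trans)
  then show "\<exists>a \<gamma> I. rest_curve R a \<gamma> p p \<and> has_curve_integral m e F a \<gamma> I"
    using rest_curve_in_ball[of p r h R p p] by (metis centre_in_ball)
  fix x assume x: "x \<in> C"
  obtain r h where r: "r > 0" "ball x r \<subseteq> C"
      and h: "\<And>x'. x' \<in> ball x r \<Longrightarrow> (h has_derivative m (\<phi> x')) (at x')"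
    using ball_in_regular_domain[OF x CR(2,1)] by blast
  show "\<exists>T. openin (top_of_set C) T \<and> x \<in> T \<and> (\<forall>y\<in>T. \<forall>z\<in>T.
      (\<exists>a \<gamma> I. rest_curve R a \<gamma> p y \<and> has_curve_integral m e F a \<gamma> I) \<longrightarrow>
      (\<exists>a \<gamma> I. rest_curve R a \<gamma> p z \<and> has_curve_integral m e F a \<gamma> I))"
  proof (intro exI[of _ "ball x r"] conjI ballI impI)
    show "openin (top_of_set C) (ball x r)" using r(2) by (simp add: open_subset)
    show "x \<in> ball x r" using r(1) by simp
    fix y z assume yz: "y \<in> ball x r" "z \<in> ball x r"
      and "\<exists>a \<gamma> I. rest_curve R a \<gamma> p y \<and> has_curve_integral m e F a \<gamma> I"
    then obtain a \<gamma> I where \<gamma>: "rest_curve R a \<gamma> p y" "has_curve_integral m e F a \<gamma> I"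
      by blast
    obtain b \<delta> where \<delta>: "rest_curve R b \<delta> y z" "has_curve_integral m e F b \<delta> (h z - h y)"
      using rest_curve_in_ball[OF h _ yz] r(2) CR(1) by blast
    show "\<exists>a \<gamma> I. rest_curve R a \<gamma> p z \<and> has_curve_integral m e F a \<gamma> I"
      using rest_curve_join[OF \<gamma>(1) \<delta>(1) \<gamma>(2) \<delta>(2)] by blast
  qed
qed

text \<open>A branch on a ball around \<open>w\<close> is the local primitive, shifted by the integral \<open>I\<close> over some
curve from the base point to \<open>w\<close>. Its value at \<open>p\<close> is the integral over that curve
continued by the straight piece from \<open>w\<close> to \<open>p\<close>.\<close>

lemma H_branch_exists:
  assumes base: "\<forall>C \<in> components R. base C \<in> C" and w: "w \<in> R"
  obtains U h where "w \<in> U" "H_branch m e F \<Omega> base U h"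
proof -
  let ?C = "connected_component_set R w"
  obtain r h where r: "r > 0" "ball w r \<subseteq> R"
      and h: "\<And>x. x \<in> ball w r \<Longrightarrow> (h has_derivative m (\<phi> x)) (at x)"
    using ball_in_regular_domain[OF w open_regular_domain order_refl] by blast
  have C: "?C \<in> components R" using w by (simp add: componentsI)
  have wC: "w \<in> ?C" using w by simp
  obtain a \<gamma> I where \<gamma>: "rest_curve R a \<gamma> (base ?C) w" "has_curve_integral m e F a \<gamma> I"
    using rest_curve_in_component[OF C _ wC] base C by blast
  have ww: "w \<in> ball w r" using r(1) by simp
  define k where "k p = I + (h p - h w)" for p
  have "H_branch m e F \<Omega> base (ball w r) k"
    unfolding H_branch_def
  proof (intro conjI ballI allI impI)
    fix p assume p: "p \<in> ball w r"
    obtain b \<delta> where "rest_curve R b \<delta> w p" "has_curve_integral m e F b \<delta> (h p - h w)"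
      using rest_curve_in_ball[OF h r(2) ww p] by blast
    from rest_curve_join[OF \<gamma>(1) this(1) \<gamma>(2) this(2)]
    have "\<exists>a \<gamma>. differentiable_curve R a \<gamma> (base ?C) p \<and> has_curve_integral m e F a \<gamma> (k p)"
      using rest_curve_imp_differentiable_curve unfolding k_def by blast
    moreover have "connected_component_set R p = ?C"
    proof -
      have "ball w r \<subseteq> ?C" using r by (intro connected_component_maximal) auto
      then show ?thesis using p connected_component_eq by blast
    qed
    ultimately show "k p \<in> H_values m e F \<Omega> base p"
      unfolding H_values_def by simp
  next
    fix a \<gamma> p q assume "differentiable_curve (ball w r) a \<gamma> p q"
    from primitive_imp_curve_integral[OF h this]
    show "has_curve_integral m e F a \<gamma> (k q - k p)" by (simp add: k_def)
  qed (use r in auto)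
  then show ?thesis using that r(1) by (metis centre_in_ball)
qed

text \<open>Increments of a branch and of a local primitive are the integral over the same curve, so the two
differ by a constant near \<open>w\<close>.\<close>

lemma H_branch_has_derivative:
  assumes "H_branch m e F \<Omega> base U k" "w \<in> U"
  shows "(k has_derivative m (\<phi> w)) (at w)"
proof -
  have U: "open U" "U \<subseteq> R"
    and k: "\<And>a \<gamma> p q. differentiable_curve U a \<gamma> p q \<Longrightarrow> has_curve_integral m e F a \<gamma> (k q - k p)"
    using assms(1) unfolding H_branch_def by blast+
  obtain r h where r: "r > 0" "ball w r \<subseteq> U"
      and h: "\<And>x. x \<in> ball w r \<Longrightarrow> (h has_derivative m (\<phi> x)) (at x)"
    using ball_in_regular_domain[OF assms(2) U] by blast
  have ww: "w \<in> ball w r" using r(1) by simp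
  have eq: "h p + (k w - h w) = k p" if p: "p \<in> ball w r" for p
  proof -
    obtain a \<gamma> where \<gamma>: "rest_curve U a \<gamma> w p" "has_curve_integral m e F a \<gamma> (h p - h w)"
      using rest_curve_in_ball[OF h r(2) ww p] by blast
    then have "has_curve_integral m e F a \<gamma> (k p - k w)"
      using k rest_curve_imp_differentiable_curve by blast
    with \<gamma>(2) have "h p - h w = k p - k w"
      unfolding has_curve_integral_def by (rule has_integral_unique)
    then show ?thesis by (simp add: algebra_simps)
  qed
  have "((\<lambda>p. h p + (k w - h w)) has_derivative m (\<phi> w)) (at w)"
    using h[of w] r(1) by (auto intro!: derivative_eq_intros)
  then show ?thesis
    by (rule has_derivative_transform_within_open[of _ _ _ _ "ball w r"]) (use eq r in auto)
qed

lemma H_pullback_natural_metric: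
  assumes base: "\<forall>C \<in> components R. base C \<in> C" and w: "w \<in> R"
  shows "H_pullback m e F \<Omega> base natural_metric w u v = m (\<phi> w) u \<bullet> m (\<phi> w) v"
proof -
  have pb: "pullback k natural_metric w = (\<lambda>u v. m (\<phi> w) u \<bullet> m (\<phi> w) v)"
    if "H_branch m e F \<Omega> base U k" "w \<in> U" for U k
    using frechet_derivative_at[OF H_branch_has_derivative[OF that]]
    by (simp add: pullback_def natural_metric_def fun_eq_iff)
  obtain U k where "w \<in> U" "H_branch m e F \<Omega> base U k"
    using H_branch_exists[OF base w] by blast
  then have "H_pullback m e F \<Omega> base natural_metric w = (\<lambda>u v. m (\<phi> w) u \<bullet> m (\<phi> w) v)"
    unfolding H_pullback_def using pb by (intro the_equality) (auto, metis)
  then show ?thesis by simp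
qed

end

section \<open>The linear system\<close>

lemma vector_matrix_mult_inner:
  fixes x y :: "real^'n" and G :: "real^'n^'n"
  shows "(A ** G ** transpose B) $ i $ j = (A $ i v* G) \<bullet> (B $ j)"
  by (simp add: matrix_matrix_mult_def vector_matrix_mult_def transpose_def inner_vec_def mult.commute)

lemma transpose_eq_self_entry:
  assumes "transpose G = G"
  shows "G $ i $ j = G $ j $ i"
proof -
  have "transpose G $ i $ j = G $ j $ i" by (simp add: transpose_def)
  then show ?thesis unfolding assms .
qed

lemma symmetric_matrix_entries:
  "symmetric_matrix a1 a2 a3 a4 a5 a6 $ 1 = vector [a1, a2, a3]"
  "symmetric_matrix a1 a2 a3 a4 a5 a6 $ 2 = vector [a2, a4, a5]"
  "symmetric_matrix a1 a2 a3 a4 a5 a6 $ 3 = vector [a3, a5, a6]"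
  by (simp_all add: symmetric_matrix_def)

lemma symmetric_matrix_eq_iff:
  "symmetric_matrix b1 b2 b3 b4 b5 b6 = symmetric_matrix a1 a2 a3 a4 a5 a6 \<longleftrightarrow>
    (b1, b2, b3, b4, b5, b6) = (a1, a2, a3, a4, a5, a6)"
  by (auto simp: vec_eq_iff forall_3 symmetric_matrix_entries)

lemma transpose_symmetric_matrix:
  "transpose (symmetric_matrix a1 a2 a3 a4 a5 a6) = symmetric_matrix a1 a2 a3 a4 a5 a6"
  by (simp add: vec_eq_iff forall_3 symmetric_matrix_entries transpose_def)

lemma symmetric_matrix_exhaust:
  assumes "transpose G = G"
  obtains a1 a2 a3 a4 a5 a6 where "G = symmetric_matrix a1 a2 a3 a4 a5 a6"
proof
  show "G = symmetric_matrix (G$1$1) (G$1$2) (G$1$3) (G$2$2) (G$2$3) (G$3$3)"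
    using transpose_eq_self_entry[OF assms, of 2 1] transpose_eq_self_entry[OF assms, of 3 1]
      transpose_eq_self_entry[OF assms, of 3 2]
    by (simp add: vec_eq_iff forall_3 symmetric_matrix_entries)
qed

context R3_algebra
begin

text \<open>The matrix of multiplication by \<open>c\<close> for row vectors: its rows are the products
\<open>e\<^sub>i c\<close>, so for \<open>c = F w\<close> they are the vectors \<open>E\<^sub>i\<close> of the linear system.\<close>

definition mult_matrix :: "real^3 \<Rightarrow> real^3^3" where
  "mult_matrix c = (\<chi> i. m (axis i 1) c)"

lemma vector_mult_matrix: "x v* mult_matrix c = m x c"
proof -
  have "x v* mult_matrix c = (\<Sum>i\<in>UNIV. x $ i *\<^sub>R m (axis i 1) c)"
    by (simp add: vec_eq_iff vector_matrix_mult_def mult_matrix_def mult.commute)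
  also have "\<dots> = m (\<Sum>i\<in>UNIV. x $ i *\<^sub>R axis i 1) c"
    by (simp add: sum_left scaleR_left)
  also have "(\<Sum>i\<in>UNIV. x $ i *\<^sub>R axis i 1) = x"
    using basis_expansion[of x] by (simp add: scalar_mult_eq_scaleR)
  finally show ?thesis .
qed

lemma mult_matrix_mult: "mult_matrix a ** mult_matrix b = mult_matrix (m a b)"
proof -
  have "(mult_matrix a ** mult_matrix b) $ i = mult_matrix a $ i v* mult_matrix b" for i
    by (simp add: vec_eq_iff matrix_matrix_mult_def vector_matrix_mult_def mult.commute)
  also have "\<dots> i = mult_matrix (m a b) $ i" for i
    by (simp add: vector_mult_matrix) (simp add: mult_matrix_def assoc)
  finally show ?thesis by (simp add: vec_eq_iff)
qed

lemma mult_matrix_unit: "mult_matrix e = mat 1"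
  by (simp add: mult_matrix_def unit_right vec_eq_iff mat_def axis_def)

text \<open>The numbers \<open>E\<^sub>i G E\<^sub>j\<^sup>T\<close> are the entries of \<open>A G A\<^sup>T\<close>, where \<open>A\<close> has rows
\<open>E\<^sub>i\<close>. Since that matrix is symmetric, the six equations account for all nine entries.\<close>

lemma frame_system_iff_congruence:
  assumes "transpose G = G"
  shows "frame_system m F w c G \<longleftrightarrow> mult_matrix (F w) ** G ** transpose (mult_matrix (F w)) = mat c"
    (is "_ \<longleftrightarrow> ?A ** G ** transpose ?A = _")
proof -
  define X where "X = ?A ** G ** transpose ?A"
  have X: "X $ i $ j = (m (axis i 1) (F w) v* G) \<bullet> m (axis j 1) (F w)" for i j
    unfolding X_def vector_matrix_mult_inner by (simp add: mult_matrix_def)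
  have "transpose X = X"
    unfolding X_def by (simp add: matrix_transpose_mul assms matrix_mul_assoc)
  note sym = transpose_eq_self_entry[OF this]
  have "frame_system m F w c G \<longleftrightarrow> X$1$1 = c \<and> X$2$2 = c \<and> X$3$3 = c \<and>
      X$1$2 = 0 \<and> X$1$3 = 0 \<and> X$2$3 = 0"
    by (simp only: frame_system_def Let_def X)
  also have "\<dots> \<longleftrightarrow> X = mat c"
    using sym[of 2 1] sym[of 3 1] sym[of 3 2]
    by (auto simp: vec_eq_iff forall_3 mat_def)
  also have "\<dots> \<longleftrightarrow> ?A ** G ** transpose ?A = mat c" by (simp only: X_def)
  finally show ?thesis .
qed

text \<open>For regular \<open>F w\<close> the matrix with rows \<open>E\<^sub>i\<close> is inverted by \<open>M\<close>, the matrix of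
multiplication by \<open>e / F w\<close>, so that the congruence can be solved for \<open>G\<close>.\<close>

lemma frame_system_iff:
  assumes "F w \<in> regular_elements m e" "transpose G = G"
  defines "M \<equiv> mult_matrix (alg_inverse m e (F w))"
  shows "frame_system m F w c G \<longleftrightarrow> G = c *\<^sub>R (M ** transpose M)"
proof -
  let ?A = "mult_matrix (F w)"
  have AM: "?A ** M = mat 1"
    by (simp add: M_def mult_matrix_mult mult_alg_inverse[OF assms(1)] mult_matrix_unit)
  then have MA: "M ** ?A = mat 1" by (simp add: matrix_left_right_inverse)
  have tAM: "transpose M ** transpose ?A = mat 1" and tMA: "transpose ?A ** transpose M = mat 1"
    using arg_cong[OF AM, of transpose] arg_cong[OF MA, of transpose]
    by (simp_all add: matrix_transpose_mul transpose_mat)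
  have "?A ** G ** transpose ?A = mat c \<longleftrightarrow> G = M ** mat c ** transpose M"
  proof
    assume "?A ** G ** transpose ?A = mat c"
    then have "M ** mat c ** transpose M = (M ** ?A) ** G ** (transpose ?A ** transpose M)"
      by (metis matrix_mul_assoc)
    then show "G = M ** mat c ** transpose M" by (simp add: MA tMA)
  next
    assume "G = M ** mat c ** transpose M"
    then have "?A ** G ** transpose ?A = (?A ** M) ** mat c ** (transpose M ** transpose ?A)"
      by (metis matrix_mul_assoc)
    then show "?A ** G ** transpose ?A = mat c" by (simp add: AM tAM)
  qed
  also have "M ** mat c ** transpose M = c *\<^sub>R (M ** transpose M)"
  proof -
    have "M ** mat c = c *\<^sub>R M"
      by (simp add: vec_eq_iff forall_3 matrix_matrix_mult_def mat_def sum_3)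
    then show ?thesis
      by (simp add: vec_eq_iff matrix_matrix_mult_def sum_distrib_left mult.assoc)
  qed
  finally show ?thesis using frame_system_iff_congruence[OF assms(2)] by blast
qed

lemma inverse_gram_nonzero:
  fixes F :: "real^3 \<Rightarrow> real^3"
  assumes "F w \<in> regular_elements m e"
  defines "M \<equiv> mult_matrix (alg_inverse m e (F w))"
  shows "M ** transpose M \<noteq> 0"
proof
  assume "M ** transpose M = 0"
  then have "frame_system m F w 1 0"
    using frame_system_iff[of F w 0 1] assms(1) by (simp add: M_def transpose_def vec_eq_iff)
  then show False by (simp add: frame_system_def Let_def)
qed

end

section \<open>The metric as solution of the system\<close>

lemma (in algebrizable_field) coefficient_matrix_alg_metric:
  assumes "\<forall>C \<in> components R. base C \<in> C" "w \<in> R"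
  defines "M \<equiv> mult_matrix (\<phi> w)"
  shows "coefficient_matrix (alg_metric m e F \<Omega> base) w = (1 / (norm e)\<^sup>2) *\<^sub>R (M ** transpose M)"
proof -
  have "(M ** transpose M) $ i $ j = m (\<phi> w) (axis i 1) \<bullet> m (\<phi> w) (axis j 1)" for i j
    using vector_matrix_mult_inner[of M "mat 1" M i j]
    by (simp add: M_def mult_matrix_def comm[of _ "\<phi> w"])
  then show ?thesis
    unfolding coefficient_matrix_def alg_metric_def H_pullback_natural_metric[OF assms(1,2)]
    by (simp add: vec_eq_iff)
qed

theorem proposition5p2:
  fixes m :: "real^3 \<Rightarrow> real^3 \<Rightarrow> real^3" and e :: "real^3"
    and F :: "real^3 \<Rightarrow> real^3" and \<Omega> :: "(real^3) set"
    and base :: "(real^3) set \<Rightarrow> real^3"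
  assumes "algebra_on_R3 m e"
    and "open \<Omega>"
    and "algebrizable_on m F \<Omega>"
    and "\<forall>C \<in> components (regular_domain m e F \<Omega>). base C \<in> C"
  shows "\<forall>w \<in> regular_domain m e F \<Omega>. \<exists>a1 a2 a3 a4 a5 a6.
     coefficient_matrix (alg_metric m e F \<Omega> base) w = symmetric_matrix a1 a2 a3 a4 a5 a6 \<and>
     (\<forall>b1 b2 b3 b4 b5 b6.
        frame_system m F w (1 / (norm e)\<^sup>2) (symmetric_matrix b1 b2 b3 b4 b5 b6) \<longleftrightarrow>
        (b1, b2, b3, b4, b5, b6) = (a1, a2, a3, a4, a5, a6)) \<and>
     ((\<forall>b1 b2 b3 b4 b5 b6.
        frame_system m F w 1 (symmetric_matrix b1 b2 b3 b4 b5 b6) \<longleftrightarrow>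
        (b1, b2, b3, b4, b5, b6) = (a1, a2, a3, a4, a5, a6)) \<longleftrightarrow> norm e = 1)"
proof
  interpret algebrizable_field m e F \<Omega>
    by unfold_locales (rule assms)+
  fix w assume w: "w \<in> R"
  then have reg: "F w \<in> regular_elements m e" by (simp add: regular_domain_def)
  define M where "M = mult_matrix (\<phi> w)"
  define P where "P = M ** transpose M"
  let ?G = "coefficient_matrix (alg_metric m e F \<Omega> base) w"
  have G: "?G = (1 / (norm e)\<^sup>2) *\<^sub>R P"
    using coefficient_matrix_alg_metric[OF assms(4) w] by (simp add: P_def M_def)
  have frame: "frame_system m F w c (symmetric_matrix b1 b2 b3 b4 b5 b6) \<longleftrightarrow>
      symmetric_matrix b1 b2 b3 b4 b5 b6 = c *\<^sub>R P" for c b1 b2 b3 b4 b5 b6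
    using frame_system_iff[of F w, OF reg transpose_symmetric_matrix] by (simp add: P_def M_def)
  have "transpose P = P" unfolding P_def by (simp add: matrix_transpose_mul)
  then have tG: "transpose (c *\<^sub>R P) = c *\<^sub>R P" for c
    by (simp add: transpose_scalar)
  obtain a1 a2 a3 a4 a5 a6 where a: "?G = symmetric_matrix a1 a2 a3 a4 a5 a6"
    using symmetric_matrix_exhaust[OF tG] unfolding G by metis
  have sys: "frame_system m F w (1 / (norm e)\<^sup>2) (symmetric_matrix b1 b2 b3 b4 b5 b6) \<longleftrightarrow>
      (b1, b2, b3, b4, b5, b6) = (a1, a2, a3, a4, a5, a6)" for b1 b2 b3 b4 b5 b6
    unfolding frame G[symmetric] a symmetric_matrix_eq_iff ..
  have "norm e = 1"
    if "\<forall>b1 b2 b3 b4 b5 b6. frame_system m F w 1 (symmetric_matrix b1 b2 b3 b4 b5 b6) \<longleftrightarrow>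
        (b1, b2, b3, b4, b5, b6) = (a1, a2, a3, a4, a5, a6)"
  proof -
    have "frame_system m F w 1 (symmetric_matrix a1 a2 a3 a4 a5 a6)" using that by blast
    then have "P = (1 / (norm e)\<^sup>2) *\<^sub>R P" using frame a G by simp
    then have "(1 / (norm e)\<^sup>2 - 1) *\<^sub>R P = 0" by (simp add: scaleR_left_diff_distrib)
    moreover have "P \<noteq> 0" using inverse_gram_nonzero[of F w, OF reg] by (simp add: P_def M_def)
    ultimately have "(norm e)\<^sup>2 = 1" by auto
    then show ?thesis using power2_eq_1_iff[of "norm e"] norm_ge_zero[of e] by linarith
  qed
  then have "(\<forall>b1 b2 b3 b4 b5 b6. frame_system m F w 1 (symmetric_matrix b1 b2 b3 b4 b5 b6) \<longleftrightarrow>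
      (b1, b2, b3, b4, b5, b6) = (a1, a2, a3, a4, a5, a6)) \<longleftrightarrow> norm e = 1"
    using sys by auto
  with a sys show "\<exists>a1 a2 a3 a4 a5 a6. ?G = symmetric_matrix a1 a2 a3 a4 a5 a6 \<and>
     (\<forall>b1 b2 b3 b4 b5 b6.
        frame_system m F w (1 / (norm e)\<^sup>2) (symmetric_matrix b1 b2 b3 b4 b5 b6) \<longleftrightarrow>
        (b1, b2, b3, b4, b5, b6) = (a1, a2, a3, a4, a5, a6)) \<and>
     ((\<forall>b1 b2 b3 b4 b5 b6.
        frame_system m F w 1 (symmetric_matrix b1 b2 b3 b4 b5 b6) \<longleftrightarrow>
        (b1, b2, b3, b4, b5, b6) = (a1, a2, a3, a4, a5, a6)) \<longleftrightarrow> norm e = 1)"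
    by blast
qed

end
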